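(* Every (Lebesgue measurable) cyclical monotone set $\Gamma\subset\mathbb{R}^3$ satisfies $\lambda^3(\Gamma)=0$, where $\lambda^3$ is the three-dimensional Lebesgue measure.
   Context: For a finite non-empty set $G\subset\mathbb{R}^3$ let $\pi_G$ be the uniform probability measure on $G$. A finite set $G'\subset\mathbb{R}^3$ is called a competitor of $G$ if $\pi_G$ and $\pi_{G'}$ have the same projections (push-forwards) onto the $xy$-, $yz$- and $xz$-coordinate planes. A set $\Gamma\subset\mathbb{R}^3$ is called cyclical monotone if for every natural $n$ and every $G\subset\Gamma$ of cardinality $n$ one has $\int xyz\,d\pi_{G'}\le\int xyz\,d\pi_G$ for every competitor $G'$ of $G$. *)

theory Defs
  imports "HOL-Probability.Probability"
begin

definition proj_xy :: "real ^ 3 \<Rightarrow> real \<times> real" where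
  "proj_xy p = (p $ 1, p $ 2)"

definition proj_yz :: "real ^ 3 \<Rightarrow> real \<times> real" where
  "proj_yz p = (p $ 2, p $ 3)"

definition proj_xz :: "real ^ 3 \<Rightarrow> real \<times> real" where
  "proj_xz p = (p $ 1, p $ 3)"

text \<open>
  The uniform probability measure on a finite non-empty set \<open>G\<close> is \<open>pmf_of_set G\<close>.
  As \<open>pmf_of_set {}\<close> is unspecified, a competitor is required to be non-empty;
  it need not have the same cardinality as \<open>G\<close>, nor be disjoint from it.
\<close>

definition competitor :: "(real ^ 3) set \<Rightarrow> (real ^ 3) set \<Rightarrow> bool" where
  "competitor G G' \<longleftrightarrow> finite G' \<and> G' \<noteq> {} \<and>
     map_pmf proj_xy (pmf_of_set G) = map_pmf proj_xy (pmf_of_set G') \<and>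
     map_pmf proj_yz (pmf_of_set G) = map_pmf proj_yz (pmf_of_set G') \<and>
     map_pmf proj_xz (pmf_of_set G) = map_pmf proj_xz (pmf_of_set G')"

definition cyclical_monotone :: "(real ^ 3) set \<Rightarrow> bool" where
  "cyclical_monotone \<Gamma> \<longleftrightarrow>
     (\<forall>n\<ge>1. \<forall>G\<subseteq>\<Gamma>. finite G \<and> card G = n \<longrightarrow>
        (\<forall>G'. competitor G G' \<longrightarrow>
           measure_pmf.expectation (pmf_of_set G') (\<lambda>p. p $ 1 * p $ 2 * p $ 3)
           \<le> measure_pmf.expectation (pmf_of_set G) (\<lambda>p. p $ 1 * p $ 2 * p $ 3)))"

end

(* The even vertices of an axis-parallel box with sides a, b, c > 0 and its odd vertices have
   the same planar projections, while the sums of xyz over the two vertex sets differ by abc.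
   So a cyclical monotone set never contains the even vertices of a cube, taken with respect to
   the vertex minimising all coordinates. A set of positive measure contains a translated copy of
   every sufficiently small dilate of any finite set: choose a compact subset K and an open U
   containing K, not much larger than K; finitely many small translates of K all lie in U and each
   of them misses so little of U that they must meet. *)
theory Submission
  imports Defs
begin

text \<open>Up to a null set, \<open>S\<close> is a countable union of compact sets; if all of these
  were null, \<open>S\<close> would be null too.\<close>

lemma not_null_obtains_compact:
  fixes S :: "'a::euclidean_space set"
  assumes "S \<in> sets lebesgue" "S \<notin> null_sets lebesgue"
  obtains K where "compact K" "K \<subseteq> S" "K \<notin> null_sets lebesgue"
proof -
  obtain C T where C: "fsigma C" "T \<in> null_sets lebesgue" "C \<union> T = S"
    using lebesgue_set_almost_fsigma[OF assms(1)] by metis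
  obtain F :: "nat \<Rightarrow> 'a set" where F: "range F \<subseteq> Collect compact" "C = (\<Union>n. F n)"
    using C(1) unfolding fsigma_Union_compact by auto
  have "\<exists>n. F n \<notin> null_sets lebesgue"
  proof (rule ccontr)
    assume "\<not> ?thesis"
    then have "C \<in> null_sets lebesgue"
      unfolding F(2) by (intro null_sets_UN) auto
    then show False
      using assms(2) C by auto
  qed
  then show thesis
    using that F C(3) by blast
qed

lemma not_null_contains_dilate:
  fixes S :: "'a::euclidean_space set"
  assumes S: "S \<in> sets lebesgue" "S \<notin> null_sets lebesgue" and "finite V"
  obtains h x where "h > 0" "\<And>v. v \<in> V \<Longrightarrow> x + h *\<^sub>R v \<in> S"
proof -
  obtain K where K: "compact K" "K \<subseteq> S" "K \<notin> null_sets lebesgue"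
    using not_null_obtains_compact[OF S] .
  have Km: "K \<in> lmeasurable"
    using K(1) by (rule lmeasurable_compact)
  have pos: "measure lebesgue K > 0"
    using K(3) Km by (metis completion.complete_measure_axioms fmeasurableD measure_nonneg
        negligible_iff_measure0 negligible_iff_null_sets order_le_less)
  \<comment> \<open>The gaps \<open>U - L v\<close> will each have measure below \<open>r\<close>,
    hence together at most \<open>card V * r\<close>, which is less than the measure of
    \<open>K\<close>. The \<open>+ 1\<close> makes this strict and covers empty
    \<open>V\<close>.\<close>
  define r where "r = measure lebesgue K / (real (card V) + 1)"
  have "r > 0"
    using pos by (simp add: r_def)
  obtain U where U: "open U" "K \<subseteq> U" "U - K \<in> lmeasurable" "emeasure lebesgue (U - K) < ennreal r"
    using sets_lebesgue_outer_open[OF fmeasurableD[OF Km] \<open>r > 0\<close>] .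
  have UK: "measure lebesgue (U - K) < r"
    using U(3,4) by (simp add: emeasure_eq_measure2 ennreal_less_iff)
  have "U = K \<union> (U - K)"
    using U(2) by blast
  then have Um: "U \<in> lmeasurable"
    using Km U(3) by (metis fmeasurable.Un)
  obtain e where e: "e > 0" "(\<Union>x\<in>K. ball x e) \<subseteq> U"
    using compact_subset_open_imp_ball_epsilon_subset[OF K(1) U(1,2)] .
  obtain B where B: "B > 0" "\<And>v. v \<in> V \<Longrightarrow> norm v \<le> B"
    using finite_imp_bounded[OF \<open>finite V\<close>] unfolding bounded_pos by blast
  \<comment> \<open>This scale keeps every shift \<open>h *\<^sub>R v\<close> shorter than
    \<open>e\<close>, so that the translates of \<open>K\<close> stay inside
    \<open>U\<close>.\<close>
  define h where "h = e / (2 * B)"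
  have h: "h > 0" "h * B < e"
    using e(1) B(1) by (auto simp: h_def)
  define L where "L v = (+) (- (h *\<^sub>R v)) ` K" for v
  have Lm: "L v \<in> lmeasurable" for v
    unfolding L_def using Km by (rule measurable_translation)
  have LU: "L v \<subseteq> U" if "v \<in> V" for v
  proof -
    have "h * norm v \<le> h * B"
      using B(2)[OF that] h(1) by simp
    also note h(2)
    finally have "norm (h *\<^sub>R v) < e"
      using h(1) by simp
    then have "- (h *\<^sub>R v) + k \<in> ball k e" for k
      by (simp add: dist_norm)
    then show ?thesis
      using e(2) unfolding L_def by blast
  qed
  \<comment> \<open>By translation invariance \<open>L v\<close> misses exactly as much of
    \<open>U\<close> as \<open>K\<close> does.\<close>
  have gap: "measure lebesgue (U - L v) < r" if "v \<in> V" for v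
  proof -
    have "measure lebesgue (U - L v) = measure lebesgue U - measure lebesgue (L v)"
      using Um Lm LU[OF that] by (intro measurable_measure_Diff) auto
    also have "measure lebesgue (L v) = measure lebesgue K"
      unfolding L_def by (rule measure_translation)
    also have "measure lebesgue U - measure lebesgue K = measure lebesgue (U - K)"
      using Um Km U(2) by (intro measurable_measure_Diff[symmetric]) auto
    finally show ?thesis
      using UK by simp
  qed
  have "measure lebesgue (\<Union>v\<in>V. U - L v) \<le> (\<Sum>v\<in>V. measure lebesgue (U - L v))"
    using \<open>finite V\<close> Um Lm by (intro measure_UNION_le) auto
  also have "\<dots> \<le> (\<Sum>v\<in>V. r)"
    using gap by (intro sum_mono) (simp add: less_imp_le)
  also have "\<dots> < measure lebesgue K"
    using pos by (simp add: r_def field_simps)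
  also have "\<dots> \<le> measure lebesgue U"
    using Um Km U(2) by (intro measure_mono_fmeasurable) auto
  \<comment> \<open>The gaps are too small to cover \<open>U\<close>, so some point of
    \<open>U\<close> lies in all the translates.\<close>
  finally have "(\<Union>v\<in>V. U - L v) \<noteq> U"
    by auto
  then obtain x where x: "x \<in> U" "\<And>v. v \<in> V \<Longrightarrow> x \<in> L v"
    by blast
  have "x + h *\<^sub>R v \<in> S" if "v \<in> V" for v
    using x(2)[OF that] K(2) by (auto simp: L_def)
  with h(1) show thesis
    using that by blast
qed

text \<open>An injective map sends a uniform measure to the uniform measure on the image, so
  comparing images suffices.\<close>

lemma map_pmf_of_set_eqI:
  assumes "inj_on f A" "inj_on f B" "f ` A = f ` B" "finite A" "A \<noteq> {}" "finite B" "B \<noteq> {}"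
  shows "map_pmf f (pmf_of_set A) = map_pmf f (pmf_of_set B)"
  using assms by (simp add: map_pmf_of_set_inj)

lemma vector_3_eq_iff:
  "(vector [a, b, c] :: real ^ 3) = vector [a', b', c'] \<longleftrightarrow> a = a' \<and> b = b' \<and> c = c'"
  by (auto simp: vec_eq_iff forall_3)

lemma cyclical_monotone_no_box:
  assumes "cyclical_monotone \<Gamma>" "a < a'" "b < b'" "c < c'"
  shows "\<not> {vector [a, b, c], vector [a, b', c'], vector [a', b, c'], vector [a', b', c]} \<subseteq> \<Gamma>"
proof
  define E :: "(real ^ 3) set" where
    "E = {vector [a, b, c], vector [a, b', c'], vector [a', b, c'], vector [a', b', c]}"
  define D :: "(real ^ 3) set" where
    "D = {vector [a', b', c'], vector [a', b, c], vector [a, b', c], vector [a, b, c']}"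
  assume "{vector [a, b, c], vector [a, b', c'], vector [a', b, c'], vector [a', b', c]} \<subseteq> \<Gamma>"
  then have sub: "E \<subseteq> \<Gamma>"
    by (simp add: E_def)
  note neq = less_imp_neq[OF assms(2)] less_imp_neq[OF assms(3)] less_imp_neq[OF assms(4)]
  have fin: "finite E" "E \<noteq> {}" "finite D" "D \<noteq> {}"
    by (auto simp: E_def D_def)
  have card: "card E = 4" "card D = 4"
    using neq neq[symmetric] by (auto simp: E_def D_def vector_3_eq_iff)
  \<comment> \<open>Each projection is injective on \<open>E\<close> and on \<open>D\<close>, and
    maps both onto the same four corners of a rectangle.\<close>
  have "competitor E D"
    unfolding competitor_def using neq neq[symmetric] fin
    by (auto intro!: map_pmf_of_set_eqI
        simp: E_def D_def proj_xy_def proj_yz_def proj_xz_def)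
  then have "measure_pmf.expectation (pmf_of_set D) (\<lambda>p. p $ 1 * p $ 2 * p $ 3)
      \<le> measure_pmf.expectation (pmf_of_set E) (\<lambda>p. p $ 1 * p $ 2 * p $ 3)"
    using assms(1)[unfolded cyclical_monotone_def, rule_format, of 4 E D] sub fin(1) card(1)
    by simp
  then have le: "(\<Sum>p\<in>D. p $ 1 * p $ 2 * p $ 3) \<le> (\<Sum>p\<in>E. p $ 1 * p $ 2 * p $ 3)"
    using fin card by (simp add: integral_pmf_of_set divide_right_mono)
  have "(\<Sum>p\<in>D. p $ 1 * p $ 2 * p $ 3) = a'*b'*c' + a'*b*c + a*b'*c + a*b*c'"
    using neq neq[symmetric] by (simp add: D_def vector_3_eq_iff)
  moreover have "(\<Sum>p\<in>E. p $ 1 * p $ 2 * p $ 3) = a*b*c + a*b'*c' + a'*b*c' + a'*b'*c"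
    using neq neq[symmetric] by (simp add: E_def vector_3_eq_iff)
  \<comment> \<open>Expanded, this product is the sum over \<open>D\<close> minus the sum over
    \<open>E\<close>.\<close>
  moreover have "(a' - a) * (b' - b) * (c' - c) > 0"
    using assms by simp
  ultimately show False
    using le by (simp add: algebra_simps)
qed

theorem corollary4p7:
  fixes \<Gamma> :: "(real ^ 3) set"
  assumes "\<Gamma> \<in> sets lebesgue"
    and "cyclical_monotone \<Gamma>"
  shows "emeasure lebesgue \<Gamma> = 0"
proof (rule ccontr)
  assume "emeasure lebesgue \<Gamma> \<noteq> 0"
  then have "\<Gamma> \<notin> null_sets lebesgue"
    by auto
  \<comment> \<open>These are the even vertices of the unit cube; their dilate by \<open>h\<close>,
    moved to \<open>x\<close>, is the forbidden configuration with all sides equal to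
    \<open>h\<close>.\<close>
  then obtain h x where h: "h > 0" and x:
    "\<And>v. v \<in> {vector [0,0,0], vector [0,1,1], vector [1,0,1], vector [1,1,0]} \<Longrightarrow> x + h *\<^sub>R v \<in> \<Gamma>"
    using not_null_contains_dilate[OF assms(1), of
        "{vector [0,0,0], vector [0,1,1], vector [1,0,1], vector [1,1,0]}"]
    by (metis finite.emptyI finite.insertI)
  have shift: "x + h *\<^sub>R vector [a, b, c] = vector [x $ 1 + h * a, x $ 2 + h * b, x $ 3 + h * c]"
    for a b c
    by (simp add: vec_eq_iff forall_3)
  have "{vector [x $ 1, x $ 2, x $ 3], vector [x $ 1, x $ 2 + h, x $ 3 + h],
      vector [x $ 1 + h, x $ 2, x $ 3 + h], vector [x $ 1 + h, x $ 2 + h, x $ 3]} \<subseteq> \<Gamma>"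
    using x[of "vector [0,0,0]"] x[of "vector [0,1,1]"] x[of "vector [1,0,1]"]
      x[of "vector [1,1,0]"]
    by (simp add: shift)
  then show False
    using cyclical_monotone_no_box[OF assms(2), of "x $ 1" "x $ 1 + h" "x $ 2" "x $ 2 + h"
        "x $ 3" "x $ 3 + h"] h
    by simp
qed

end
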